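(* The automorphisms $\widehat{\alpha}_p(\xi,k)=(\xi-kp,k)$, $p\in\mathcal{P}$, of $\widehat{G}=\widehat{\mathbf{R}}\times\mathbb{Z}$ have Property X for $\Gamma^\perp$, where $\Gamma=\Lambda\times\mathbb{T}$ and $\Lambda$ is a closed cocompact subgroup of $\mathbf{R}$.
   Context: $\mathbf{R}$ is a locally compact second countable abelian group (not necessarily the real line), $\widehat{\mathbf{R}}$ its dual group written additively with identity $\mathrm{e}_{\widehat{\mathbf{R}}}$, and $e^{2\pi i\langle p,x\rangle}$ denotes the value of the character $p\in\widehat{\mathbf{R}}$ at $x\in\mathbf{R}$. $G=\mathbf{R}\times\mathbb{T}$, so $\widehat{G}=\widehat{\mathbf{R}}\times\mathbb{Z}$ with identity $\mathrm{e}=(\mathrm{e}_{\widehat{\mathbf{R}}},0)$. $\mathcal{P}\subset\widehat{\mathbf{R}}$, endowed with a $\sigma$-finite Borel measure $\varsigma$. The automorphisms $\widehat{\alpha}_p$ are dual to $\alpha_p(x,e^{2\pi i\theta})=(x,e^{2\pi i(\theta+\langle p,x\rangle)})$ on $G$, which preserve Haar measure, so their modulus is $\delta(p)=1$. Here $kp$ is the $k$-fold sum of $p$ in $\widehat{\mathbf{R}}$ (of $-p$, $|k|$ times, if $k<0$; the identity if $k=0$). $\Gamma^\perp\subset\widehat{G}$ is the annihilator of $\Gamma$ (a discrete subgroup). $\widehat{\mathbf{R}}$ has a translation-invariant metric $d_{\widehat{\mathbf{R}}}$ inducing its topology, with compact closed balls, weakly doubling (there are $r_0,C>0$ such that the Haar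 measure of the ball of radius $2r$ about the identity is at most $C$ times that of the ball of radius $r$, for all $r<r_0$); $\|p\|=d_{\widehat{\mathbf{R}}}(p,\mathrm{e}_{\widehat{\mathbf{R}}})$ is assumed $\varsigma$-measurable on $\mathcal{P}$. $\widehat{G}$ has the invariant metric $d_{\widehat{G}}((\xi,k),(\eta,l))=d_{\widehat{\mathbf{R}}}(\xi,\eta)+|k-l|$, with open balls $B(\cdot,r)$. With respect to it $\widehat{\alpha}_p$ is bi-Lipschitz with upper constant $L(p)=1+\|p\|$. Property X for $\Gamma^\perp$: there exist $r>0$, $M>0$, $C>0$ such that $\sharp(\Gamma^\perp\cap\widehat{\alpha}_pB(\mathrm{e},r))\le1+C\,\delta(p)$ for all $p\in\mathcal{P}$ with $L(p)>M$. *)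

theory Defs
  imports "HOL-Analysis.Analysis"
begin

section \<open>The dual group\<close>

text \<open>
  Continuous unitary characters, written additively. The value of \<open>p\<close> at \<open>x\<close>, informally
  \<open>exp (2 pi i <p,x>)\<close>, is \<open>char_val p x\<close>. The topology is the compact-open topology.
\<close>

typedef (overloaded) 'a dual =
  "{\<phi> :: 'a::{topological_space, ab_group_add} \<Rightarrow> complex.
      continuous_on UNIV \<phi> \<and> (\<forall>x. norm (\<phi> x) = 1) \<and> (\<forall>x y. \<phi> (x + y) = \<phi> x * \<phi> y)}"
  morphisms char_val Abs_dual
  by (intro exI[of _ "\<lambda>_. 1"]) auto

instantiation dual :: ("{topological_space, ab_group_add}") ab_group_add
begin

definition "0 = Abs_dual (\<lambda>_. 1)"
definition "p + q = Abs_dual (\<lambda>x. char_val p x * char_val q x)"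
definition "- p = Abs_dual (\<lambda>x. cnj (char_val p x))"
definition "p - q = p + - (q :: 'a dual)"

lemma char_val_zero [simp]: "char_val 0 x = 1"
  by (simp add: zero_dual_def Abs_dual_inverse)

lemma char_val_plus [simp]: "char_val (p + q) x = char_val p x * char_val q x"
  using char_val[of p] char_val[of q]
  by (simp add: plus_dual_def Abs_dual_inverse continuous_on_mult norm_mult ac_simps)

lemma char_val_uminus [simp]: "char_val (- p) x = cnj (char_val p x)"
  using char_val[of p]
  by (simp add: uminus_dual_def Abs_dual_inverse continuous_on_cnj)

lemma norm_char_val [simp]: "norm (char_val p x) = 1"
  using char_val[of p] by simp

lemma dual_eqI: "(\<And>x. char_val p x = char_val q x) \<Longrightarrow> p = q"
  by (simp add: char_val_inject[symmetric] fun_eq_iff)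

instance
proof
  fix p q r :: "'a dual"
  show "p + q + r = p + (q + r)" "p + q = q + p" "0 + p = p"
    by (auto intro!: dual_eqI)
  show "- p + p = 0"
    by (rule dual_eqI) (simp add: mult.commute[of "cnj _"] complex_norm_square[symmetric])
qed (simp add: minus_dual_def)

end

instantiation dual :: ("{topological_space, ab_group_add}") topological_space
begin

definition open_dual :: "'a dual set \<Rightarrow> bool" where
  "open_dual = generate_topology
     {W. \<exists>K V. compact K \<and> open V \<and> W = {p. char_val p ` K \<subseteq> V}}"

instance
proof
  show "open (UNIV :: 'a dual set)"
    by (simp add: open_dual_def generate_topology.UNIV)
qed (auto simp: open_dual_def intro: generate_topology.Int generate_topology.UN)

end


section \<open>The circle group\<close>

text \<open>
  The unit circle in the complex plane. Its group law, multiplication of complex numbers, is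
  also written additively, so that products such as \<open>'a \<times> circle\<close> are additive groups.
\<close>

typedef circle = "{z :: complex. norm z = 1}"
  morphisms circle_val Abs_circle
  by (intro exI[of _ 1]) simp

instantiation circle :: ab_group_add
begin

definition "0 = Abs_circle 1"
definition "z + w = Abs_circle (circle_val z * circle_val w)"
definition "- z = Abs_circle (cnj (circle_val z))"
definition "z - w = z + - (w :: circle)"

lemma norm_circle_val [simp]: "norm (circle_val z) = 1"
  using circle_val[of z] by simp

lemma circle_val_zero [simp]: "circle_val 0 = 1"
  by (simp add: zero_circle_def Abs_circle_inverse)

lemma circle_val_plus [simp]: "circle_val (z + w) = circle_val z * circle_val w"
  by (simp add: plus_circle_def Abs_circle_inverse norm_mult)

lemma circle_val_uminus [simp]: "circle_val (- z) = cnj (circle_val z)"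
  by (simp add: uminus_circle_def Abs_circle_inverse)

instance
proof
  fix z w v :: circle
  show "z + w + v = z + (w + v)" "z + w = w + z" "0 + z = z"
    by (simp_all add: circle_val_inject[symmetric] ac_simps)
  show "- z + z = 0"
    by (simp add: circle_val_inject[symmetric] mult.commute[of "cnj _"]
        complex_norm_square[symmetric])
qed (simp add: minus_circle_def)

end

instantiation circle :: topological_space
begin

definition open_circle :: "circle set \<Rightarrow> bool" where
  "open_circle U \<longleftrightarrow> (\<exists>V. open V \<and> U = circle_val -` V)"

instance
proof
  show "open (UNIV :: circle set)"
    unfolding open_circle_def by (intro exI[of _ UNIV]) auto
next
  fix S T :: "circle set"
  assume "open S" "open T"
  then obtain V W where "open V" "S = circle_val -` V" "open W" "T = circle_val -` W"
    unfolding open_circle_def by blast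
  then show "open (S \<inter> T)"
    unfolding open_circle_def by (intro exI[of _ "V \<inter> W"]) auto
next
  fix \<S> :: "circle set set"
  assume "\<forall>S\<in>\<S>. open S"
  then obtain f where "\<And>S. S \<in> \<S> \<Longrightarrow> open (f S) \<and> S = circle_val -` f S"
    unfolding open_circle_def by metis
  then show "open (\<Union>\<S>)"
    unfolding open_circle_def by (intro exI[of _ "\<Union>(f ` \<S>)"]) blast
qed

end


section \<open>Subgroups, quotients and Haar measure\<close>

definition is_subgroup :: "'g::ab_group_add set \<Rightarrow> bool" where
  "is_subgroup H \<longleftrightarrow> 0 \<in> H \<and> (\<forall>x\<in>H. \<forall>y\<in>H. x + y \<in> H) \<and> (\<forall>x\<in>H. - x \<in> H)"

definition coset_of :: "'g::ab_group_add set \<Rightarrow> 'g \<Rightarrow> 'g set" where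
  "coset_of H x = (+) x ` H"

definition quotient_group_topology ::
  "'g::{topological_space, ab_group_add} set \<Rightarrow> 'g set topology" where
  "quotient_group_topology H =
     topology (\<lambda>U. U \<subseteq> range (coset_of H) \<and> open (coset_of H -` U))"

lemma openin_quotient_group_topology:
  "openin (quotient_group_topology H) U \<longleftrightarrow>
     U \<subseteq> range (coset_of H) \<and> open (coset_of H -` U)"
proof -
  have "istopology (\<lambda>U. U \<subseteq> range (coset_of H) \<and> open (coset_of H -` U))"
    unfolding istopology_def by (auto simp: vimage_Union)
  then show ?thesis
    by (simp add: quotient_group_topology_def)
qed

definition cocompact :: "'g::{topological_space, ab_group_add} set \<Rightarrow> bool" where
  "cocompact H \<longleftrightarrow> compact_space (quotient_group_topology H)"

text \<open>
  No regularity is required: on a locally compact second countable Hausdorff space every Borel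
  measure that is finite on compact sets is regular.
\<close>

definition haar_measure :: "'g::{topological_space, ab_group_add} measure \<Rightarrow> bool" where
  "haar_measure \<mu> \<longleftrightarrow>
     sets \<mu> = sets borel \<and>
     (\<forall>K. compact K \<longrightarrow> emeasure \<mu> K < \<infinity>) \<and>
     (\<forall>U. open U \<and> U \<noteq> {} \<longrightarrow> 0 < emeasure \<mu> U) \<and>
     (\<forall>x. \<forall>E\<in>sets borel. emeasure \<mu> ((+) x ` E) = emeasure \<mu> E)"

definition is_modulus ::
  "'g::{topological_space, ab_group_add} measure \<Rightarrow> ('g \<Rightarrow> 'g) \<Rightarrow> real \<Rightarrow> bool" where
  "is_modulus \<mu> \<alpha> c \<longleftrightarrow>
     0 < c \<and> (\<forall>E\<in>sets borel. emeasure \<mu> (\<alpha> ` E) = ennreal c * emeasure \<mu> E)"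

definition weakly_doubling :: "('g \<Rightarrow> 'g \<Rightarrow> real) \<Rightarrow> 'g::zero measure \<Rightarrow> bool" where
  "weakly_doubling d \<mu> \<longleftrightarrow>
     (\<exists>r0>0. \<exists>C>0. \<forall>r. 0 < r \<and> r < r0 \<longrightarrow>
        emeasure \<mu> (Metric_space.mball UNIV d 0 (2 * r))
          \<le> ennreal C * emeasure \<mu> (Metric_space.mball UNIV d 0 r))"


section \<open>Automorphisms of the product with the circle and of its dual\<close>

definition int_mult :: "int \<Rightarrow> 'g::ab_group_add \<Rightarrow> 'g" where
  "int_mult k p = (if 0 \<le> k then (\<Sum>i<nat k. p) else (\<Sum>i<nat (- k). - p))"

text \<open>
  The dual of \<open>'a \<times> circle\<close> is identified with \<open>'a dual \<times> int\<close>, where \<open>(\<xi>, k)\<close> is the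
  character whose value at \<open>(x, z)\<close> is \<open>\<xi>(x) z\<^sup>k\<close>.
\<close>

definition pairing ::
  "'a dual \<times> int \<Rightarrow> 'a::{topological_space, ab_group_add} \<times> circle \<Rightarrow> complex" where
  "pairing \<phi> g = char_val (fst \<phi>) (fst g) * circle_val (snd g) powi snd \<phi>"

definition annihilator ::
  "('a::{topological_space, ab_group_add} \<times> circle) set \<Rightarrow> ('a dual \<times> int) set" where
  "annihilator \<Gamma> = {\<phi>. \<forall>g\<in>\<Gamma>. pairing \<phi> g = 1}"

definition alpha ::
  "'a dual \<Rightarrow> 'a::{topological_space, ab_group_add} \<times> circle \<Rightarrow> 'a \<times> circle" where
  "alpha p g = (fst g, snd g + Abs_circle (char_val p (fst g)))"

definition alpha_hat ::
  "'a dual \<Rightarrow> 'a::{topological_space, ab_group_add} dual \<times> int \<Rightarrow> 'a dual \<times> int" where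
  "alpha_hat p \<phi> = (fst \<phi> - int_mult (snd \<phi>) p, snd \<phi>)"

lemma char_val_int_mult: "char_val (int_mult k p) x = char_val p x powi k"
proof -
  have sum: "char_val (\<Sum>i<n. q) x = char_val q x ^ n" for q :: "'a dual" and n :: nat
    by (induction n) (simp_all add: mult.commute)
  have "cnj (char_val p x) = inverse (char_val p x)"
    by (simp add: inverse_complex_def complex_eq_iff cmod_power2[symmetric])
  then show ?thesis
    by (simp only: int_mult_def sum power_int_def char_val_uminus split: if_splits) simp
qed

text \<open>The sense in which \<open>alpha_hat p\<close> is dual to \<open>alpha p\<close>.\<close>

lemma pairing_alpha_hat_alpha: "pairing (alpha_hat p \<phi>) (alpha p g) = pairing \<phi> g"
proof -
  let ?c = "char_val p (fst g)"
  have "cnj ?c * ?c = 1"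
    by (simp add: mult.commute[of "cnj _"] complex_norm_square[symmetric])
  then have "cnj ?c powi snd \<phi> * ?c powi snd \<phi> = 1"
    by (simp add: power_int_mult_distrib[symmetric])
  then show ?thesis
    by (simp add: pairing_def alpha_def alpha_hat_def diff_conv_add_uminus char_val_int_mult
        Abs_circle_inverse power_int_mult_distrib del: add_uminus_conv_diff)
qed

definition dist_product ::
  "('g \<Rightarrow> 'g \<Rightarrow> real) \<Rightarrow> 'g \<times> int \<Rightarrow> 'g \<times> int \<Rightarrow> real" where
  "dist_product d \<phi> \<psi> = d (fst \<phi>) (fst \<psi>) + \<bar>real_of_int (snd \<phi> - snd \<psi>)\<bar>"

text \<open>
  Property X of the family \<open>\<tau>\<close> of maps, indexed by \<open>P\<close>, for the set \<open>D\<close>; here \<open>\<delta>\<close> are the moduli,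
  \<open>L\<close> the upper Lipschitz constants, and \<open>d\<close> the metric of the ambient group. Finiteness is
  required explicitly because \<open>card\<close> is \<open>0\<close> on infinite sets.
\<close>

definition property_X ::
  "('g \<Rightarrow> 'g \<Rightarrow> real) \<Rightarrow> 'p set \<Rightarrow> ('p \<Rightarrow> 'g \<Rightarrow> 'g) \<Rightarrow> ('p \<Rightarrow> real) \<Rightarrow> ('p \<Rightarrow> real) \<Rightarrow>
     'g::zero set \<Rightarrow> bool" where
  "property_X d P \<tau> \<delta> L D \<longleftrightarrow>
     (\<exists>r>0. \<exists>M>0. \<exists>C>0. \<forall>p\<in>P. L p > M \<longrightarrow>
        finite (D \<inter> \<tau> p ` Metric_space.mball UNIV d 0 r) \<and>
        real (card (D \<inter> \<tau> p ` Metric_space.mball UNIV d 0 r)) \<le> 1 + C * \<delta> p)"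

end

theory Submission
  imports Defs
begin

text \<open>
  A ball of radius at most 1 about the identity only contains points \<open>(\<xi>, 0)\<close>, and every
  \<open>alpha_hat p\<close> fixes these. So it suffices that the annihilator of \<open>\<Lambda>\<close> meets some neighbourhood
  of the identity only in the identity. By cocompactness, \<open>K + \<Lambda>\<close> is the whole group for some
  compact \<open>K\<close>. A character that is trivial on \<open>\<Lambda>\<close> and maps \<open>K\<close> into the right half-plane therefore
  maps the whole group there, and the circle has no nontrivial subgroup in that half-plane.
\<close>

text \<open>On the unit circle Re(w^2) = 2 (Re w)^2 - 1, so in the right half-plane squaring at
  least doubles the defect 1 - Re w. A nonzero defect of \<open>z\<close> would exceed 1 after
  enough squarings, forcing a negative real part.\<close>

lemma unit_complex_powers_Re_pos_eq_1:
  fixes z :: complex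
  assumes norm: "norm z = 1" and pos: "\<And>n. 0 < Re (z ^ n)"
  shows "z = 1"
proof -
  have double: "2 * (1 - Re w) \<le> 1 - Re (w\<^sup>2)" if "norm w = 1" "0 < Re w" for w :: complex
  proof -
    have 1: "(Re w)\<^sup>2 + (Im w)\<^sup>2 = 1"
      using that(1) by (simp add: cmod_power2[symmetric])
    have "Re w \<le> 1"
      using complex_Re_le_cmod[of w] that(1) by simp
    then have "Re w * Re w \<le> Re w * 1"
      using that(2) by (intro mult_left_mono) auto
    then show ?thesis
      using 1 by (simp add: Re_power2 power2_eq_square)
  qed
  have grow: "2 ^ n * (1 - Re z) \<le> 1 - Re (z ^ (2 ^ n))" for n
  proof (induction n)
    case (Suc n)
    have "2 * (1 - Re (z ^ (2 ^ n))) \<le> 1 - Re ((z ^ (2 ^ n))\<^sup>2)"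
      using norm pos by (intro double) (simp_all add: norm_power)
    moreover have "(z ^ (2 ^ n))\<^sup>2 = z ^ (2 ^ Suc n)"
      by (simp add: power_mult[symmetric] mult.commute)
    ultimately show ?case
      using Suc.IH by simp
  qed simp
  have le: "Re z \<le> 1"
    using complex_Re_le_cmod[of z] norm by simp
  have "\<not> 0 < 1 - Re z"
  proof
    assume *: "0 < 1 - Re z"
    \<comment> \<open>\<open>n\<close> is large enough that the lower bound in \<open>grow\<close>
      passes 1.\<close>
    obtain n where "1 / (1 - Re z) < 2 ^ n"
      using real_arch_pow[of 2 "1 / (1 - Re z)"] by auto
    then have "1 < 2 ^ n * (1 - Re z)"
      using * by (simp add: pos_divide_less_eq)
    then show False
      using grow[of n] pos[of "2 ^ n"] by linarith
  qed
  then have Re: "Re z = 1"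
    using le by linarith
  moreover have "(Re z)\<^sup>2 + (Im z)\<^sup>2 = 1"
    using norm by (simp add: cmod_power2[symmetric])
  ultimately show ?thesis
    by (simp add: complex_eq_iff)
qed

lemma coset_of_eq_iff:
  assumes "is_subgroup H"
  shows "coset_of H x = coset_of H y \<longleftrightarrow> x - y \<in> H"
proof
  assume "coset_of H x = coset_of H y"
  moreover have "x \<in> coset_of H x"
    using assms unfolding coset_of_def is_subgroup_def by (force intro: image_eqI[of _ _ 0])
  ultimately obtain h where "h \<in> H" "x = y + h"
    unfolding coset_of_def by blast
  then show "x - y \<in> H" by simp
next
  have sub: "coset_of H x \<subseteq> coset_of H y" if "x - y \<in> H" for x y
  proof
    fix z assume "z \<in> coset_of H x"
    then obtain h where "h \<in> H" "z = x + h"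
      unfolding coset_of_def by blast
    then have "z = y + ((x - y) + h)" "(x - y) + h \<in> H"
      using assms that unfolding is_subgroup_def by (auto simp: algebra_simps)
    then show "z \<in> coset_of H y"
      unfolding coset_of_def by blast
  qed
  assume *: "x - y \<in> H"
  then have "- (x - y) \<in> H"
    using assms unfolding is_subgroup_def by blast
  then show "coset_of H x = coset_of H y"
    using sub[OF *] sub[of y x] by simp
qed

text \<open>The quotient map is open because the saturation of \<open>U\<close> is the union of its
  translates by elements of \<open>H\<close>, each of them open.\<close>

lemma openin_coset_of_image:
  fixes H :: "'a::topological_ab_group_add set"
  assumes "is_subgroup H" "open U"
  shows "openin (quotient_group_topology H) (coset_of H ` U)"
proof -
  have "coset_of H -` (coset_of H ` U) = (\<Union>h\<in>H. (\<lambda>y. y - h) -` U)"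
  proof (intro set_eqI iffI)
    fix y assume "y \<in> coset_of H -` (coset_of H ` U)"
    then obtain u where "u \<in> U" "y - u \<in> H"
      using coset_of_eq_iff[OF assms(1)] by auto
    then show "y \<in> (\<Union>h\<in>H. (\<lambda>y. y - h) -` U)"
      by (intro UN_I[of "y - u"]) auto
  next
    fix y assume "y \<in> (\<Union>h\<in>H. (\<lambda>y. y - h) -` U)"
    then obtain h where "h \<in> H" "y - h \<in> U" by auto
    then show "y \<in> coset_of H -` (coset_of H ` U)"
      using coset_of_eq_iff[OF assms(1), of y "y - h"] by auto
  qed
  moreover have "open ((\<lambda>y. y - h) -` U)" for h
    by (intro continuous_open_vimage assms continuous_intros)
  ultimately show ?thesis
    by (auto simp: openin_quotient_group_topology)
qed

text \<open>Every point has an open neighbourhood \<open>U x\<close> inside a compact set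
  \<open>K x\<close>. The images of the \<open>U x\<close> form an open cover of the compact
  quotient, and the union of the \<open>K x\<close> over a finite subcover meets every
  coset.\<close>

lemma cocompact_obtains_compact:
  fixes H :: "'a::topological_ab_group_add set"
  assumes "locally_compact_space (euclidean :: 'a topology)" "is_subgroup H" "cocompact H"
  obtains K where "compact K" "\<And>x. \<exists>k\<in>K. x - k \<in> H"
proof -
  have "\<forall>x::'a. \<exists>U K. open U \<and> compact K \<and> x \<in> U \<and> U \<subseteq> K"
    using assms(1) unfolding locally_compact_space_def by simp
  then obtain U K where UK: "\<And>x::'a. open (U x) \<and> compact (K x) \<and> x \<in> U x \<and> U x \<subseteq> K x"
    by metis
  let ?\<U> = "(\<lambda>x. coset_of H ` U x) ` UNIV"
  have top: "topspace (quotient_group_topology H) \<subseteq> range (coset_of H)"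
    using openin_topspace[of "quotient_group_topology H"]
    unfolding openin_quotient_group_topology by simp
  have cover: "range (coset_of H) \<subseteq> \<Union>?\<U>"
    using UK by blast
  have "openin (quotient_group_topology H) V" if "V \<in> ?\<U>" for V
    using that UK openin_coset_of_image[OF assms(2)] by auto
  then have "\<exists>\<F>. finite \<F> \<and> \<F> \<subseteq> ?\<U> \<and> topspace (quotient_group_topology H) \<subseteq> \<Union>\<F>"
    using subset_trans[OF top cover]
    by (intro assms(3)[unfolded cocompact_def compact_space_alt, rule_format]) simp
  then obtain \<F> where
    \<F>: "finite \<F>" "\<F> \<subseteq> ?\<U>" "topspace (quotient_group_topology H) \<subseteq> \<Union>\<F>"
    by (elim exE conjE)
  from finite_subset_image[OF \<F>(1,2)] obtain F
    where F: "finite F" "\<F> = (\<lambda>x. coset_of H ` U x) ` F"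
    by (elim exE conjE)
  show thesis
  proof
    show "compact (\<Union>x\<in>F. K x)"
      using F(1) UK by auto
  next
    fix x
    \<comment> \<open>This gives the inclusion converse to \<open>top\<close>: every coset is a
      point of the quotient space, hence is covered by the finite subfamily.\<close>
    have "openin (quotient_group_topology H) (range (coset_of H))"
      by (rule openin_coset_of_image[OF assms(2) open_UNIV])
    then have "coset_of H x \<in> \<Union>\<F>"
      using openin_subset \<F>(3) by blast
    then obtain y u where "y \<in> F" "u \<in> U y" "coset_of H x = coset_of H u"
      using F(2) by auto
    then show "\<exists>k\<in>(\<Union>x\<in>F. K x). x - k \<in> H"
      using UK coset_of_eq_iff[OF assms(2)] by blast
  qed
qed

lemma open_dual_compact_open:
  fixes K :: "'a::{topological_space, ab_group_add} set"
  assumes "compact K" "open V"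
  shows "open {p. char_val p ` K \<subseteq> V}"
  unfolding open_dual_def using assms by (intro generate_topology.Basis) blast

lemma char_val_diff: "char_val p (x - y) = char_val p x / char_val p y"
proof -
  have "char_val p (x - y + y) = char_val p (x - y) * char_val p y"
    using char_val[of p] by blast
  moreover have "char_val p y \<noteq> 0"
    using norm_char_val[of p y] by force
  ultimately show ?thesis
    by (simp add: field_simps)
qed

text \<open>Powers of a value of \<open>p\<close> are again values of \<open>p\<close>, at multiples
  of the argument, so all of them have positive real part and the lemma on powers applies.\<close>

lemma char_val_Re_pos_imp_zero:
  assumes "\<And>x. 0 < Re (char_val p x)"
  shows "p = 0"
proof (rule dual_eqI)
  fix x
  have zero: "char_val p 0 = 1"
    \<comment> \<open>The value at 0 is a quotient of equal numbers, nonzero because they have norm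
      1.\<close>
    using char_val_diff[of p x x] norm_char_val[of p x] by (cases "char_val p x = 0") simp_all
  have "\<exists>y. char_val p x ^ n = char_val p y" for n
  proof (induction n)
    case 0
    show ?case
      by (rule exI[of _ 0]) (simp add: zero)
  next
    case (Suc n)
    then obtain y where "char_val p x ^ n = char_val p y" ..
    then have "char_val p x ^ Suc n = char_val p (x + y)"
      using char_val[of p] by simp
    then show ?case ..
  qed
  then have "0 < Re (char_val p x ^ n)" for n
    using assms by metis
  then show "char_val p x = char_val 0 x"
    using unit_complex_powers_Re_pos_eq_1[of "char_val p x"] by simp
qed

text \<open>A character trivial on \<open>H\<close> is determined by its values on a compact set
  \<open>K\<close> meeting all cosets. The condition that it maps \<open>K\<close> into the open
  right half-plane is a subbasic open set of the compact-open topology.\<close>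

lemma cocompact_annihilator_discrete:
  fixes H :: "'a::topological_ab_group_add set"
  assumes "locally_compact_space (euclidean :: 'a topology)" "is_subgroup H" "cocompact H"
  obtains W where "open W" "0 \<in> W" "\<And>p. p \<in> W \<Longrightarrow> (\<And>x. x \<in> H \<Longrightarrow> char_val p x = 1) \<Longrightarrow> p = 0"
proof -
  obtain K where K: "compact K" "\<And>x. \<exists>k\<in>K. x - k \<in> H"
    using cocompact_obtains_compact[OF assms] by blast
  let ?W = "{p. char_val p ` K \<subseteq> {z. 0 < Re z}}"
  show thesis
  proof
    show "open ?W"
      by (intro open_dual_compact_open K(1) open_halfspace_Re_gt)
    show "0 \<in> ?W"
      by auto
  next
    fix p assume p: "p \<in> ?W" and triv: "\<And>x. x \<in> H \<Longrightarrow> char_val p x = 1"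
    show "p = 0"
    proof (rule char_val_Re_pos_imp_zero)
      fix x
      obtain k where "k \<in> K" "x - k \<in> H"
        using K(2) by blast
      then have "char_val p x = char_val p k"
        using triv[of "x - k"] by (simp add: char_val_diff divide_eq_1_iff)
      then show "0 < Re (char_val p x)"
        using p \<open>k \<in> K\<close> by auto
    qed
  qed
qed

theorem lemma29:
  fixes \<Lambda> :: "'a::{topological_ab_group_add, second_countable_topology, t2_space} set"
    and d :: "'a dual \<Rightarrow> 'a dual \<Rightarrow> real"
    and \<mu> :: "'a dual measure"
    and \<mu>G :: "('a \<times> circle) measure"
    and P :: "'a dual set"
    and \<sigma> :: "'a dual measure"
    and \<delta> :: "'a dual \<Rightarrow> real"
  assumes "locally_compact_space (euclidean :: 'a topology)"
    and "Metric_space UNIV d"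
    and "Metric_space.mtopology UNIV d = euclidean"
    and "\<And>\<xi> \<eta> \<zeta>. d (\<xi> + \<zeta>) (\<eta> + \<zeta>) = d \<xi> \<eta>"
    and "\<And>\<xi> r. compact (Metric_space.mcball UNIV d \<xi> r)"
    and "haar_measure \<mu>"
    and "weakly_doubling d \<mu>"
    and "sets \<sigma> = sets (restrict_space borel P)"
    and "sigma_finite_measure \<sigma>"
    and "(\<lambda>p. d p 0) \<in> borel_measurable \<sigma>"
    and "haar_measure \<mu>G"
    and "\<And>p. p \<in> P \<Longrightarrow> is_modulus \<mu>G (alpha p) (\<delta> p)"
    and "is_subgroup \<Lambda>"
    and "closed \<Lambda>"
    and "cocompact \<Lambda>"
  shows "property_X (dist_product d) P alpha_hat \<delta> (\<lambda>p. 1 + d p 0) (annihilator (\<Lambda> \<times> UNIV))"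
proof -
  interpret Metric_space UNIV d by fact
  obtain W where W: "open W" "0 \<in> W"
    "\<And>p. p \<in> W \<Longrightarrow> (\<And>x. x \<in> \<Lambda> \<Longrightarrow> char_val p x = 1) \<Longrightarrow> p = 0"
    using cocompact_annihilator_discrete[OF assms(1,13,15)] by blast
  have "openin mtopology W"
    using W(1) assms(3) by simp
  then obtain \<epsilon> where \<epsilon>: "0 < \<epsilon>" "mball 0 \<epsilon> \<subseteq> W"
    using W(2) unfolding openin_mtopology by blast
  \<comment> \<open>The bound \<epsilon> puts the first component into \<open>W\<close>; the bound 1
    makes the integer component vanish.\<close>
  let ?r = "min \<epsilon> 1"
  interpret prod: Metric_space UNIV "dist_product d"
  proof
    fix x y z
    show "0 \<le> dist_product d x y"
      by (simp add: dist_product_def)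
    show "dist_product d x y = dist_product d y x"
      by (simp add: dist_product_def commute abs_minus_commute)
    show "dist_product d x y = 0 \<longleftrightarrow> x = y"
      by (simp add: dist_product_def prod_eq_iff add_nonneg_eq_0_iff)
    show "dist_product d x z \<le> dist_product d x y + dist_product d y z"
      using triangle[of "fst x" "fst y" "fst z"] by (simp add: dist_product_def)
  qed
  have sub: "annihilator (\<Lambda> \<times> UNIV) \<inter> alpha_hat p ` prod.mball 0 ?r \<subseteq> {0}" for p
  proof
    fix \<phi> assume \<phi>: "\<phi> \<in> annihilator (\<Lambda> \<times> UNIV) \<inter> alpha_hat p ` prod.mball 0 ?r"
    then obtain \<psi> where \<psi>: "\<phi> = alpha_hat p \<psi>" "dist_product d 0 \<psi> < ?r"
      by auto
    have dist: "d 0 (fst \<psi>) + \<bar>real_of_int (snd \<psi>)\<bar> < ?r"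
      using \<psi>(2) by (simp add: dist_product_def)
    then have "\<bar>real_of_int (snd \<psi>)\<bar> < 1"
      using nonneg[of 0 "fst \<psi>"] by linarith
    then have snd: "snd \<psi> = 0"
      by linarith
    \<comment> \<open>\<open>int_mult 0 p\<close> is an empty sum, so \<open>alpha_hat p\<close>
      fixes every point with integer component 0.\<close>
    then have eq: "\<phi> = \<psi>"
      using \<psi>(1) by (simp add: alpha_hat_def int_mult_def prod_eq_iff)
    have "fst \<psi> \<in> W"
      using dist \<epsilon>(2) by auto
    moreover have "char_val (fst \<psi>) x = 1" if "x \<in> \<Lambda>" for x
    proof -
      have "pairing \<phi> (x, 0) = 1"
        using \<phi> that unfolding annihilator_def by blast
      then show ?thesis
        using snd eq by (simp add: pairing_def)
    qed
    ultimately have "fst \<psi> = 0"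
      by (rule W(3))
    then show "\<phi> \<in> {0}"
      using snd eq by (simp add: prod_eq_iff)
  qed
  \<comment> \<open>By \<open>sub\<close> there is at most one point in the intersection, and the
    modulus is positive; hence the bound with coefficient 1.\<close>
  have "finite (annihilator (\<Lambda> \<times> UNIV) \<inter> alpha_hat p ` prod.mball 0 ?r) \<and>
      real (card (annihilator (\<Lambda> \<times> UNIV) \<inter> alpha_hat p ` prod.mball 0 ?r)) \<le> 1 + 1 * \<delta> p"
    if "p \<in> P" for p
  proof -
    have "0 < \<delta> p"
      using assms(12)[OF that] by (simp add: is_modulus_def)
    then show ?thesis
      using finite_subset[OF sub[of p]] card_mono[OF _ sub[of p]] by simp
  qed
  then show ?thesis
    unfolding property_X_def using \<epsilon>(1)
    \<comment> \<open>The estimate was shown for every \<open>p\<close> in \<open>P\<close>, so 1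
      serves both as the threshold M and as the constant C.\<close>
    by (intro exI[of _ ?r] exI[of _ "1::real"] conjI) auto
qed

end
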